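(* Consider the online algorithm described in the context (with $L\ge1$ updates per stage). Its updates are valid: whenever $X_t^{(L)}(\xi_{1:t})$ is evaluated, all the needed information is available in $\mathsf{Memory}$. Denote by $\overline{\mathsf{Memory}}_0$ the content of the shared memory at the start of the algorithm and by $\overline{\mathsf{Memory}}_t$ its content at the end of stage $t$. Then $$\overline{\mathsf{Memory}}_t=\overline{\mathsf{Memory}}_0\cup\{X_t^{(1)}(\xi_{1:t}),\dots,X_t^{(L)}(\xi_{1:t}),\,X_t(\xi_{1:t})\},$$ that is, $\overline{\mathsf{Memory}}_t\setminus\overline{\mathsf{Memory}}_0$ contains $L+1$ vectors in $\mathcal X_t$. The oracle complexity (the total number over all $T$ stages) for the stochastic conditional gradient and for the proximal update is $O(T\cdot\min(2^L,L^T))$. Further assuming that, for every $t$, all vectors in $\mathcal X_t$ can be stored with $B$ bits, $\mathsf{Memory}\setminus\overline{\mathsf{Memory}}_0$ takes no more than $O(L^2B)$ bits throughout the algorithm.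
   Context: **Setting.** $T$ stages; $\Xi_t\subset\mathbb R^{k_t}$ are outcome sets with $\Xi_1$ a singleton, $\Xi_{1:t}=\Xi_1\times\dots\times\Xi_t$, $\Xi=\Xi_{1:T}$; $\mathcal X_t\subset\mathbb R^{n_t}$ nonempty compact convex; $f_1(x_1,\xi_1)$ and $f_t(x_{t-1},x_t,\xi_t)$, $t\ge2$, are convex and differentiable in the $x$-variables. $v_t:\mathcal X_t\to\mathbb R$ is a convex continuous function, $1$-strongly convex and continuously differentiable on the convex set $\mathcal X_t^o$ of minimizers over $\mathcal X_t$ of functions $v_t+\langle g,\cdot\rangle$, $g\in\mathbb R^{n_t}$; $D_{v_t}(y,x)=v_t(y)-v_t(x)-\langle\nabla v_t(x),y-x\rangle$. $\widehat{\boldsymbol\xi}_{t+1}:\Xi_{1:t}\times[0,1]\to\Xi_{t+1}$ are given functions (scenario samplers). Fixed data: seeds $\zeta_{t,l}\in[0,1]$ ($1\le t\le T$, $0\le l\le L$), initial policies $X_t^{(0)}:\Xi_{1:t}\to\mathcal X_t^o$, step sizes $\gamma_0,\dots,\gamma_L>0$. **Policies.** For all $\xi\in\Xi$ and $l\ge0$, $$X_t^{(l+1)}(\xi_{1:t})=\arg\min_{x_t\in\mathcal X_t}\langle\gamma_lG_t^{(l)}(\xi_{1:t}),x_t\rangle+D_{v_t}(x_t,X_t^{(l)}(\xi_{1:t}))\qquad(\text{proximal update}),$$ where the stochastic conditional gradient is, with $\hat\xi_{t+1}=\widehat{\boldsymbol\xi}_{t+1}(\xi_{1:t},\zeta_{t,l})$,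 $$G_t^{(l)}(\xi_{1:t})=\tfrac{\partial f_t}{\partial x_t}\big(X_{t-1}^{(l)}(\xi_{1:(t-1)}),X_t^{(l)}(\xi_{1:t}),\xi_t\big)+\tfrac{\partial f_{t+1}}{\partial x_t}\big(X_t^{(l)}(\xi_{1:t}),X_{t+1}^{(l)}(\xi_{1:t},\hat\xi_{t+1}),\hat\xi_{t+1}\big)$$ (for $t=1$ the argument $X_{t-1}^{(l)}$ is absent; for $t=T$ the second term is absent). **Memory.** All processes share a memory $\mathsf{Memory}$ (a set of stored items) with read, write and delete operations. $\mathsf{Memory}^{(init)}=\{X_t^{(0)}(\xi_{1:t}):1\le t\le T,\xi\in\Xi\}\cup\{\zeta_{t,l}:1\le t\le T,0\le l\le L\}$ is in $\mathsf{Memory}$ throughout. Only the shared memory (not the working memory used inside a single gradient computation or proximal update) is counted. **Evaluation procedure $\mathrm{Eval}(t,l,\xi_{1:t})$.** Precondition: $\mathsf{Memory}^{(init)}\subset\mathsf{Memory}$ and, if $t\ge2$, $X_{t-1}^{(l')}(\xi_{1:(t-1)})\in\mathsf{Memory}$ for $l'=0,\dots,l-1$. For $l'=1,\dots,l$ do: (Step 1, only if $t<T$) read $\zeta_{t,l'-1}$, compute $\hat\xi_{t+1}=\widehat{\boldsymbol\xi}_{t+1}(\xi_{1:t},\zeta_{t,l'-1})$ and call $\mathrm{Eval}(t+1,l'-1,(\xi_{1:t},\hat\xi_{t+1}))$; (Step 2) read $X_t^{(l'-1)}(\xi_{1:t})$, $X_{t-1}^{(l'-1)}(\xi_{1:(t-1)})$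 (if $t\ge2$) and $X_{t+1}^{(l'-1)}(\xi_{1:t},\hat\xi_{t+1})$ (if $t<T$), compute $G_t^{(l'-1)}(\xi_{1:t})$ by one gradient oracle call, then $X_t^{(l')}(\xi_{1:t})$ by one proximal update; delete the entries $X_{t+1}^{(1)},\dots,X_{t+1}^{(l'-1)}$ at $(\xi_{1:t},\hat\xi_{t+1})$ written by the Step 1 call (if $t<T$); write $X_t^{(l')}(\xi_{1:t})$. **Online algorithm.** At the start, $\mathsf{Memory}^{(init)}\subset\mathsf{Memory}$. At stage $t=1,\dots,T$: $\xi_t$ is revealed; run $\mathrm{Eval}(t,L,\xi_{1:t})$; compute $X_t(\xi_{1:t})=\sum_{l=0}^L\gamma_lX_t^{(l)}(\xi_{1:t})/\sum_{l=0}^L\gamma_l$ and write it; if $t\ge2$, delete $X_{t-1}(\xi_{1:(t-1)})$ and $X_{t-1}^{(1)}(\xi_{1:(t-1)}),\dots,X_{t-1}^{(L)}(\xi_{1:(t-1)})$.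
   Formalization: The memory at the start is assumed to contain no updated policy values X_t^(l), 1≤l≤L, and no averages X_t; otherwise the algorithm's deletions could remove items of the starting memory and the claimed memory equation would fail. *)

theory Defs
  imports "HOL-Analysis.Analysis" "HOL-Analysis.Finite_Function_Topology"
    "HOL-Library.Monad_Syntax"
begin

section \<open>Real vectors of varying dimension\<close>

text \<open>
  The dimensions depend on the stage, so vectors live in the finitely supported sequences and
  \<open>\<real>^n\<close> is the subspace supported on the first \<open>n\<close> indices.  The library norm on this type is the
  l1 norm; on each \<open>\<real>^n\<close> it is equivalent to the Euclidean one, hence \<^const>\<open>compact\<close>,
  \<^const>\<open>continuous_on\<close> and \<^const>\<open>has_derivative\<close> have their usual meaning there.  The Euclidean
  norm itself is only used through \<open>inner_prod x x\<close>.
\<close>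

type_synonym rvec = "(nat, real) poly_mapping"

definition Rn :: "nat \<Rightarrow> rvec set" where
  "Rn n = {x. Poly_Mapping.keys x \<subseteq> {..<n}}"

definition inner_prod :: "rvec \<Rightarrow> rvec \<Rightarrow> real" where
  "inner_prod x y =
     (\<Sum>i\<in>Poly_Mapping.keys x. Poly_Mapping.lookup x i * Poly_Mapping.lookup y i)"

definition strongly_convex_on :: "real \<Rightarrow> rvec set \<Rightarrow> (rvec \<Rightarrow> real) \<Rightarrow> bool" where
  "strongly_convex_on \<mu> S \<phi> \<longleftrightarrow> convex S \<and>
     (\<forall>x\<in>S. \<forall>y\<in>S. \<forall>a\<in>{0..1}.
        \<phi> (a *\<^sub>R x + (1 - a) *\<^sub>R y)
          \<le> a * \<phi> x + (1 - a) * \<phi> y - \<mu> / 2 * a * (1 - a) * inner_prod (x - y) (x - y))"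

section \<open>The multistage problem\<close>

text \<open>
  Stages are numbered from 1.  A history \<open>\<xi>\<^bsub>1:t\<^esub>\<close> is a list of length \<open>t\<close>, whose last element is
  \<open>\<xi>\<^sub>t\<close>.  The gradients are fields of the record, tied to the functions in \<open>multistage\<close>
  below: the functions are only given on the feasible sets, which need not be full-dimensional, so
  the gradient vectors need not be determined by the functions.
\<close>

record problem =
  horizon :: nat                                            \<comment> \<open>\<open>T\<close>\<close>
  updates :: nat                                            \<comment> \<open>\<open>L\<close>\<close>
  outcome_dim :: "nat \<Rightarrow> nat"                               \<comment> \<open>\<open>k\<^sub>t\<close>\<close>
  decision_dim :: "nat \<Rightarrow> nat"                              \<comment> \<open>\<open>n\<^sub>t\<close>\<close>
  outcomes :: "nat \<Rightarrow> rvec set"                             \<comment> \<open>\<open>\<Xi>\<^sub>t\<close>\<close>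
  feasible :: "nat \<Rightarrow> rvec set"                             \<comment> \<open>\<open>X\<^sub>t\<close>\<close>
  first_cost :: "rvec \<Rightarrow> rvec \<Rightarrow> real"                      \<comment> \<open>\<open>f\<^sub>1(x\<^sub>1, \<xi>\<^sub>1)\<close>\<close>
  first_grad :: "rvec \<Rightarrow> rvec \<Rightarrow> rvec"                      \<comment> \<open>\<open>\<partial>f\<^sub>1/\<partial>x\<^sub>1\<close>\<close>
  cost :: "nat \<Rightarrow> rvec \<Rightarrow> rvec \<Rightarrow> rvec \<Rightarrow> real"              \<comment> \<open>\<open>f\<^sub>t(x\<^bsub>t-1\<^esub>, x\<^sub>t, \<xi>\<^sub>t)\<close> for \<open>t \<ge> 2\<close>\<close>
  grad_prev :: "nat \<Rightarrow> rvec \<Rightarrow> rvec \<Rightarrow> rvec \<Rightarrow> rvec"         \<comment> \<open>\<open>\<partial>f\<^sub>t/\<partial>x\<^bsub>t-1\<^esub>\<close>\<close>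
  grad_cur :: "nat \<Rightarrow> rvec \<Rightarrow> rvec \<Rightarrow> rvec \<Rightarrow> rvec"          \<comment> \<open>\<open>\<partial>f\<^sub>t/\<partial>x\<^sub>t\<close>\<close>
  dgf :: "nat \<Rightarrow> rvec \<Rightarrow> real"                              \<comment> \<open>\<open>v\<^sub>t\<close>\<close>
  dgf_grad :: "nat \<Rightarrow> rvec \<Rightarrow> rvec"                         \<comment> \<open>\<open>\<nabla>v\<^sub>t\<close>\<close>
  sampler :: "nat \<Rightarrow> rvec list \<Rightarrow> real \<Rightarrow> rvec"             \<comment> \<open>sampler for \<open>\<xi>\<^sub>t\<close> given \<open>\<xi>\<^bsub>1:t-1\<^esub>\<close>\<close>
  seed :: "nat \<Rightarrow> nat \<Rightarrow> real"                              \<comment> \<open>\<open>\<zeta>\<^bsub>t,l\<^esub>\<close>\<close>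
  init_policy :: "nat \<Rightarrow> rvec list \<Rightarrow> rvec"                 \<comment> \<open>\<open>X\<^sub>t\<^sup>0\<close>\<close>
  stepsize :: "nat \<Rightarrow> real"                                 \<comment> \<open>\<open>\<gamma>\<^sub>l\<close>\<close>

definition histories :: "problem \<Rightarrow> nat \<Rightarrow> rvec list set" where
  "histories P t = {h. length h = t \<and> (\<forall>s\<in>{1..t}. h ! (s - 1) \<in> outcomes P s)}"

definition prox_domain :: "problem \<Rightarrow> nat \<Rightarrow> rvec set" where
  "prox_domain P t =
     {x. \<exists>g\<in>Rn (decision_dim P t).
           is_arg_min (\<lambda>y. dgf P t y + inner_prod g y) (\<lambda>y. y \<in> feasible P t) x}"

definition multistage :: "problem \<Rightarrow> bool" where
  "multistage P \<longleftrightarrow>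
     horizon P \<ge> 1 \<and> updates P \<ge> 1 \<and>
     (\<forall>t\<in>{1..horizon P}. outcomes P t \<subseteq> Rn (outcome_dim P t)) \<and>
     (\<exists>\<xi>\<^sub>1. outcomes P 1 = {\<xi>\<^sub>1}) \<and>
     (\<forall>t\<in>{1..horizon P}.
        feasible P t \<subseteq> Rn (decision_dim P t) \<and> feasible P t \<noteq> {} \<and>
        compact (feasible P t) \<and> convex (feasible P t)) \<and>
     (\<forall>\<xi>\<in>outcomes P 1.
        convex_on (feasible P 1) (\<lambda>x. first_cost P x \<xi>) \<and>
        (\<forall>x\<in>feasible P 1.
           first_grad P x \<xi> \<in> Rn (decision_dim P 1) \<and>
           ((\<lambda>x. first_cost P x \<xi>) has_derivative inner_prod (first_grad P x \<xi>))
             (at x within feasible P 1))) \<and>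
     (\<forall>t\<in>{2..horizon P}. \<forall>\<xi>\<in>outcomes P t.
        convex_on (feasible P (t - 1) \<times> feasible P t) (\<lambda>(x, y). cost P t x y \<xi>) \<and>
        (\<forall>x\<in>feasible P (t - 1). \<forall>y\<in>feasible P t.
           grad_prev P t x y \<xi> \<in> Rn (decision_dim P (t - 1)) \<and>
           grad_cur P t x y \<xi> \<in> Rn (decision_dim P t) \<and>
           ((\<lambda>(x, y). cost P t x y \<xi>) has_derivative
              (\<lambda>(h, k). inner_prod (grad_prev P t x y \<xi>) h + inner_prod (grad_cur P t x y \<xi>) k))
             (at (x, y) within feasible P (t - 1) \<times> feasible P t))) \<and>
     (\<forall>t\<in>{1..horizon P}.
        convex_on (feasible P t) (dgf P t) \<and> continuous_on (feasible P t) (dgf P t) \<and>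
        convex (prox_domain P t) \<and> strongly_convex_on 1 (prox_domain P t) (dgf P t) \<and>
        continuous_on (prox_domain P t) (dgf_grad P t) \<and>
        (\<forall>x\<in>prox_domain P t.
           dgf_grad P t x \<in> Rn (decision_dim P t) \<and>
           (dgf P t has_derivative inner_prod (dgf_grad P t x)) (at x within prox_domain P t))) \<and>
     (\<forall>t\<in>{1..<horizon P}. \<forall>h\<in>histories P t. \<forall>z\<in>{0..1}.
        sampler P (Suc t) h z \<in> outcomes P (Suc t)) \<and>
     (\<forall>t\<in>{1..horizon P}. \<forall>l\<le>updates P. seed P t l \<in> {0..1}) \<and>
     (\<forall>t\<in>{1..horizon P}. \<forall>h\<in>histories P t. init_policy P t h \<in> prox_domain P t) \<and>
     (\<forall>l\<le>updates P. stepsize P l > 0)"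

section \<open>Policies\<close>

definition bregman :: "problem \<Rightarrow> nat \<Rightarrow> rvec \<Rightarrow> rvec \<Rightarrow> real" where
  "bregman P t y x = dgf P t y - dgf P t x - inner_prod (dgf_grad P t x) (y - x)"

definition prox_update :: "problem \<Rightarrow> nat \<Rightarrow> nat \<Rightarrow> rvec \<Rightarrow> rvec \<Rightarrow> rvec" where
  "prox_update P t l g x =
     arg_min_on (\<lambda>y. inner_prod (stepsize P l *\<^sub>R g) y + bregman P t y x) (feasible P t)"

text \<open>
  The stochastic conditional gradient as a function of \<open>x\<^bsub>t-1\<^esub>\<close> (absent for \<open>t = 1\<close>), \<open>x\<^sub>t\<close>, \<open>\<xi>\<^sub>t\<close>,
  and of the pair of \<open>x\<^bsub>t+1\<^esub>\<close> with the sampled outcome (absent for \<open>t = T\<close>).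
\<close>

definition cond_grad ::
    "problem \<Rightarrow> nat \<Rightarrow> rvec option \<Rightarrow> rvec \<Rightarrow> rvec \<Rightarrow> (rvec \<times> rvec) option \<Rightarrow> rvec" where
  "cond_grad P t prev x \<xi> next_stage =
     (case prev of None \<Rightarrow> first_grad P x \<xi> | Some w \<Rightarrow> grad_cur P t w x \<xi>) +
     (case next_stage of None \<Rightarrow> 0 | Some (y, \<xi>') \<Rightarrow> grad_prev P (Suc t) x y \<xi>')"

fun policy :: "problem \<Rightarrow> nat \<Rightarrow> nat \<Rightarrow> rvec list \<Rightarrow> rvec" where
  "policy P 0 t h = init_policy P t h"
| "policy P (Suc l) t h =
     (let \<xi>' = sampler P (Suc t) h (seed P t l);
          g = cond_grad P t
                (if t \<ge> 2 then Some (policy P l (t - 1) (butlast h)) else None)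
                (policy P l t h) (last h)
                (if t < horizon P then Some (policy P l (Suc t) (h @ [\<xi>']), \<xi>') else None)
      in prox_update P t l g (policy P l t h))"

definition average :: "problem \<Rightarrow> (nat \<Rightarrow> rvec) \<Rightarrow> rvec" where
  "average P x = (\<Sum>l\<le>updates P. stepsize P l *\<^sub>R x l) /\<^sub>R (\<Sum>l\<le>updates P. stepsize P l)"

section \<open>Shared memory\<close>

text \<open>
  The memory is a (possibly infinite) partial map from labels to stored values; seen as a set of
  stored items it is its graph.  \<open>Iterate t l h\<close> labels \<open>X\<^sub>t\<^sup>l\<close> at history \<open>h\<close>, \<open>Average t h\<close> the
  averaged decision, \<open>Seed t l\<close> the seed; \<open>Other\<close> leaves room for data not used by the algorithm.
\<close>

datatype label = Iterate nat nat "rvec list" | Average nat "rvec list" | Seed nat nat | Other nat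

datatype stored = Vector rvec | Scalar real

type_synonym memory = "label \<rightharpoonup> stored"

definition initial_memory :: "problem \<Rightarrow> memory" where
  "initial_memory P a =
     (case a of
        Iterate t l h \<Rightarrow>
          if t \<in> {1..horizon P} \<and> l = 0 \<and> h \<in> take t ` histories P (horizon P)
          then Some (Vector (init_policy P t h)) else None
      | Seed t l \<Rightarrow>
          if t \<in> {1..horizon P} \<and> l \<le> updates P then Some (Scalar (seed P t l)) else None
      | _ \<Rightarrow> None)"

definition scratch_labels :: "problem \<Rightarrow> label set" where
  "scratch_labels P =
     {Iterate t l h | t l h. t \<in> {1..horizon P} \<and> l \<in> {1..updates P}} \<union>
     {Average t h | t h. t \<in> {1..horizon P}}"

text \<open>
  The memory at the start may contain more than the initial data, but none of the entries that the
  algorithm writes (and later deletes).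
\<close>

definition starting_memory :: "problem \<Rightarrow> memory \<Rightarrow> bool" where
  "starting_memory P M \<longleftrightarrow> initial_memory P \<subseteq>\<^sub>m M \<and> dom M \<inter> scratch_labels P = {}"

definition read_vector :: "memory \<Rightarrow> label \<Rightarrow> rvec option" where
  "read_vector M a = (case M a of Some (Vector x) \<Rightarrow> Some x | _ \<Rightarrow> None)"

definition read_scalar :: "memory \<Rightarrow> label \<Rightarrow> real option" where
  "read_scalar M a = (case M a of Some (Scalar z) \<Rightarrow> Some z | _ \<Rightarrow> None)"

section \<open>The algorithm\<close>

text \<open>
  Computations return \<^const>\<open>None\<close> as soon as an entry to be read is missing or the precondition of
  a call of the evaluation procedure is violated.  The state records all memory contents that have
  occurred so far and counts gradient computations and proximal updates.
\<close>

record state =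
  mem :: memory
  contents :: "memory set"
  grad_calls :: nat
  prox_calls :: nat

definition start :: "memory \<Rightarrow> state" where
  "start M = \<lparr>mem = M, contents = {M}, grad_calls = 0, prox_calls = 0\<rparr>"

definition set_mem :: "memory \<Rightarrow> state \<Rightarrow> state" where
  "set_mem M s = s\<lparr>mem := M, contents := insert M (contents s)\<rparr>"

definition store :: "label \<Rightarrow> rvec \<Rightarrow> state \<Rightarrow> state" where
  "store a x s = set_mem ((mem s)(a \<mapsto> Vector x)) s"

definition delete :: "label set \<Rightarrow> state \<Rightarrow> state" where
  "delete A s = set_mem (mem s |` (- A)) s"

definition count_update :: "state \<Rightarrow> state" where
  "count_update s = s\<lparr>grad_calls := grad_calls s + 1, prox_calls := prox_calls s + 1\<rparr>"

definition eval_pre :: "problem \<Rightarrow> nat \<Rightarrow> nat \<Rightarrow> rvec list \<Rightarrow> memory \<Rightarrow> bool" where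
  "eval_pre P t l h M \<longleftrightarrow>
     initial_memory P \<subseteq>\<^sub>m M \<and>
     (t \<ge> 2 \<longrightarrow>
        (\<forall>l'<l. M (Iterate (t - 1) l' (butlast h)) = Some (Vector (policy P l' (t - 1) (butlast h)))))"

text \<open>Step 2 of the evaluation procedure for \<open>l' = Suc l\<close>; \<open>sample\<close> is absent iff \<open>t = T\<close>.\<close>

definition eval_update ::
    "problem \<Rightarrow> nat \<Rightarrow> nat \<Rightarrow> rvec list \<Rightarrow> rvec option \<Rightarrow> state \<Rightarrow> state option" where
  "eval_update P t l h sample s = do {
     x \<leftarrow> read_vector (mem s) (Iterate t l h);
     prev \<leftarrow> (if t \<ge> 2
               then map_option Some (read_vector (mem s) (Iterate (t - 1) l (butlast h)))
               else Some None);
     next_stage \<leftarrow> (case sample of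
                 None \<Rightarrow> Some None
               | Some \<xi>' \<Rightarrow> map_option (\<lambda>y. Some (y, \<xi>'))
                               (read_vector (mem s) (Iterate (Suc t) l (h @ [\<xi>']))));
     let x' = prox_update P t l (cond_grad P t prev x (last h) next_stage) x;
     let s = count_update s;
     let s = (case sample of
                None \<Rightarrow> s
              | Some \<xi>' \<Rightarrow> delete {Iterate (Suc t) j (h @ [\<xi>']) | j. j \<in> {1..l}} s);
     Some (store (Iterate t (Suc l) h) x' s)
   }"

text \<open>
  \<open>eval_loop P t l h\<close> performs the iterations \<open>l' = 1, \<dots>, l\<close> of the evaluation procedure at
  \<open>(t, h)\<close>; the recursion unrolls the loop from its last iteration.
\<close>

fun eval_loop :: "problem \<Rightarrow> nat \<Rightarrow> nat \<Rightarrow> rvec list \<Rightarrow> state \<Rightarrow> state option" where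
  "eval_loop P t 0 h s = Some s"
| "eval_loop P t (Suc l) h s = do {
     s \<leftarrow> eval_loop P t l h s;
     if t < horizon P then do {
       z \<leftarrow> read_scalar (mem s) (Seed t l);
       let \<xi>' = sampler P (Suc t) h z;
       s \<leftarrow> (if eval_pre P (Suc t) l (h @ [\<xi>']) (mem s)
             then eval_loop P (Suc t) l (h @ [\<xi>']) s else None);
       eval_update P t l h (Some \<xi>') s
     } else eval_update P t l h None s
   }"

definition evaluate :: "problem \<Rightarrow> nat \<Rightarrow> nat \<Rightarrow> rvec list \<Rightarrow> state \<Rightarrow> state option" where
  "evaluate P t l h s = (if eval_pre P t l h (mem s) then eval_loop P t l h s else None)"

definition stage :: "problem \<Rightarrow> nat \<Rightarrow> rvec list \<Rightarrow> state \<Rightarrow> state option" where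
  "stage P t h s = do {
     s \<leftarrow> evaluate P t (updates P) h s;
     xs \<leftarrow> those (map (\<lambda>l. read_vector (mem s) (Iterate t l h)) [0..<Suc (updates P)]);
     let s = store (Average t h) (average P (nth xs)) s;
     Some (if t \<ge> 2
           then delete (insert (Average (t - 1) (butlast h))
                  {Iterate (t - 1) l (butlast h) | l. l \<in> {1..updates P}}) s
           else s)
   }"

text \<open>\<open>online P \<xi> t M\<close> is the state at the end of stage \<open>t\<close> on the outcomes \<open>\<xi>\<close>, started on \<open>M\<close>.\<close>

fun online :: "problem \<Rightarrow> rvec list \<Rightarrow> nat \<Rightarrow> memory \<Rightarrow> state option" where
  "online P \<xi> 0 M = Some (start M)"
| "online P \<xi> (Suc t) M = online P \<xi> t M \<bind> stage P (Suc t) (take (Suc t) \<xi>)"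

definition extra_items :: "memory \<Rightarrow> memory \<Rightarrow> (label \<times> stored) set" where
  "extra_items M M\<^sub>0 = Map.graph M - Map.graph M\<^sub>0"

end

theory Submission
  imports Defs
begin

text \<open>
  Whatever the algorithm writes under a label is the value which that label stands for: the policy
  \<open>X\<^sub>t\<^sup>l\<close> at the history in the label, or the average of the policies.  Hence a memory that
  occurs during a run is determined by the set \<open>A\<close> of labels present beyond the starting memory; it is
  \<open>overlay A\<close>.  Storing and deleting act on \<open>A\<close> as insertion and set difference, and the claims about
  memory contents become claims about finite sets of labels.

  The heart is \<open>eval_loop_run\<close>, an induction on the number \<open>l\<close> of iterations.  The last
  iteration calls the procedure at stage \<open>t + 1\<close> with one iteration less, on a sampled history that
  extends the current one.  The precondition of this call asks for the iterates at the current history,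
  which the earlier iterations have just produced.  The call adds exactly its own iterates, the update
  reads one of them, and all of them are deleted afterwards.  So the net effect of the procedure is to
  add the iterates \<open>1, \<dots>, l\<close> at the current history.  At the time of the nested call only
  \<open>l - 1\<close> own iterates are present, so a peak of at most \<open>(l - 1)\<^sup>2\<close> for the nested call gives a peak
  of at most \<open>(l - 1) + (l - 1)\<^sup>2 \<le> l\<^sup>2\<close> in addition to what was there before.

  With \<open>d\<close> stages left, the number \<open>N\<^sub>d(l)\<close> of updates satisfies
  \<open>N\<^sub>d(l + 1) = N\<^sub>d(l) + 1 + N\<^bsub>d-1\<^esub>(l)\<close> with \<open>N\<^sub>0 = 0\<close>, that is,
  \<open>N\<^sub>d(l) = \<Sum>\<^bsub>1\<le>i\<le>d\<^esub> (l choose i)\<close>.  Both bounds \<open>2\<^sup>l\<close> and \<open>l\<^sup>d\<close> follow from the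
  recursion by induction (\<open>eval_cost_le_exponential\<close>, \<open>eval_cost_le_power\<close>).

  A stage starts with the \<open>L + 1\<close> items left by the previous one.  It holds at most
  \<open>(L + 1) + L\<^sup>2\<close> items during the evaluation and at most \<open>2 (L + 1)\<close> after the average has been
  written; for \<open>L \<ge> 1\<close> both numbers are at most \<open>4 L\<^sup>2\<close>.  Every item is a feasible vector, because
  proximal updates minimize over the compact feasible set and averages are convex combinations; this
  turns the number of items into a number of bits.
\<close>

section \<open>Iterates stay feasible\<close>

text \<open>
  The distance of finitely supported sequences is the sum of the coordinate distances, so each
  coordinate is a contraction.
\<close>

lemma continuous_on_lookup:
  "continuous_on S (\<lambda>x :: rvec. Poly_Mapping.lookup x i)"
proof -
  have "dist (Poly_Mapping.lookup x i) (Poly_Mapping.lookup y i) \<le> dist x y" for x y :: rvec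
  proof (cases "i \<in> Poly_Mapping.keys x \<union> Poly_Mapping.keys y")
    case True
    then show ?thesis
      unfolding dist_poly_mapping_def by (intro member_le_sum) auto
  next
    case False
    then have "Poly_Mapping.lookup x i = 0" "Poly_Mapping.lookup y i = 0"
      by (auto simp: in_keys_iff)
    then show ?thesis by simp
  qed
  then show ?thesis
    unfolding continuous_on_iff by (meson order.strict_trans1)
qed

lemma continuous_on_inner_prod [continuous_intros]:
  assumes "continuous_on S f"
  shows "continuous_on S (\<lambda>x. inner_prod g (f x))"
  unfolding inner_prod_def
  by (intro continuous_on_sum continuous_on_mult continuous_on_const
      continuous_on_compose2[OF continuous_on_lookup assms]) auto

text \<open>
  The objective is continuous and the feasible set is compact, so the choice operator in
  \<^const>\<open>prox_update\<close> picks an actual minimizer.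
\<close>

lemma prox_update_feasible:
  assumes "multistage P" "t \<in> {1..horizon P}"
  shows "prox_update P t l g x \<in> feasible P t"
proof -
  let ?f = "\<lambda>y. inner_prod (stepsize P l *\<^sub>R g) y + bregman P t y x"
  have S: "compact (feasible P t)" "feasible P t \<noteq> {}" "continuous_on (feasible P t) (dgf P t)"
    using assms unfolding multistage_def by blast+
  have "continuous_on (feasible P t) ?f"
    unfolding bregman_def by (intro continuous_intros S(3))
  then obtain y where "is_arg_min ?f (\<lambda>y. y \<in> feasible P t) y"
    using continuous_attains_inf[OF S(1,2)] unfolding is_arg_min_linorder by blast
  then have "is_arg_min ?f (\<lambda>y. y \<in> feasible P t) (arg_min ?f (\<lambda>y. y \<in> feasible P t))"
    unfolding arg_min_def by (rule someI)
  then show ?thesis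
    by (simp add: prox_update_def arg_min_on_def is_arg_min_def)
qed

lemma policy_feasible:
  assumes "multistage P" "t \<in> {1..horizon P}" "h \<in> histories P t"
  shows "policy P l t h \<in> feasible P t"
proof (cases l)
  case 0
  have "init_policy P t h \<in> prox_domain P t"
    using assms unfolding multistage_def by blast
  then show ?thesis
    using 0 by (auto simp: prox_domain_def is_arg_min_def)
next
  case (Suc k)
  then show ?thesis
    using prox_update_feasible[OF assms(1,2)] by (simp add: Let_def)
qed

lemma average_feasible:
  assumes "multistage P" "t \<in> {1..horizon P}" and x: "\<And>l. l \<le> updates P \<Longrightarrow> x l \<in> feasible P t"
  shows "average P x \<in> feasible P t"
proof -
  let ?c = "\<Sum>l\<le>updates P. stepsize P l"
  have pos: "stepsize P l > 0" if "l \<le> updates P" for l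
    using assms(1) that unfolding multistage_def by blast
  then have c: "?c > 0"
    by (intro sum_pos) auto
  have conv: "convex (feasible P t)"
    using assms(1,2) unfolding multistage_def by blast
  have "(\<Sum>l\<le>updates P. (stepsize P l / ?c) *\<^sub>R x l) \<in> feasible P t"
  proof (rule convex_sum[OF _ conv])
    show "(\<Sum>l\<le>updates P. stepsize P l / ?c) = 1"
      using c by (simp flip: sum_divide_distrib)
    show "stepsize P l / ?c \<ge> 0" if "l \<in> {..updates P}" for l
      using that c pos[of l] by auto
  qed (use x in auto)
  then show ?thesis
    by (simp add: average_def scaleR_sum_right divide_inverse mult.commute)
qed

section \<open>Cost of an evaluation\<close>

text \<open>
  The number of updates made by \<open>l\<close> iterations at a stage from which \<open>d\<close> stages remain, itself
  included.  The case \<open>d = 0\<close> is a nonexistent stage after the last one, so that the recursion needs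
  no exception at the last stage.
\<close>

fun eval_cost :: "nat \<Rightarrow> nat \<Rightarrow> nat" where
  "eval_cost 0 d = 0"
| "eval_cost (Suc l) d = (if d = 0 then 0 else eval_cost l d + Suc (eval_cost l (d - 1)))"

lemma eval_cost_le_exponential: "eval_cost l d < 2 ^ l"
proof (induction l arbitrary: d)
  case (Suc l)
  show ?case using Suc[of d] Suc[of "d - 1"] by simp
qed simp

lemma eval_cost_no_stage: "eval_cost l 0 = 0"
  by (cases l) auto

text \<open>
  With \<open>d - 1\<close> in place of \<open>d\<close>, this gives \<open>l\<^sup>d + l\<^bsup>d-1\<^esup> + 1 \<le> (l + 1)\<^sup>d\<close> for \<open>d \<ge> 2\<close>, the inductive
  step of the polynomial bound below.
\<close>

lemma power_Suc_ge:
  assumes "d > 0"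
  shows "(l::nat) ^ d + 1 \<le> Suc l ^ d"
  using power_strict_mono[of l "Suc l" d] assms by simp

lemma eval_cost_le_power: "eval_cost l d \<le> l ^ d"
proof (induction l arbitrary: d)
  case (Suc l)
  consider "d = 0" | "d = 1" | e where "d = Suc e" "e > 0"
    by (metis One_nat_def not0_implies_Suc zero_less_Suc)
  then show ?case
  proof cases
    \<comment> \<open>For the last stage the bound \<open>l\<^sup>0 = 1\<close> on the nested cost would be too weak; that cost is \<open>0\<close>.\<close>
    case 2
    then show ?thesis using Suc[of 1] by (simp add: eval_cost_no_stage)
  next
    case 3
    have "eval_cost (Suc l) d \<le> l * l ^ e + (l ^ e + 1)"
      using Suc[of d] Suc[of e] 3 by simp
    also have "\<dots> \<le> l * Suc l ^ e + Suc l ^ e"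
      using power_Suc_ge[OF 3(2), of l] by (intro add_mono mult_le_mono2) auto
    finally show ?thesis using 3 by simp
  qed simp
qed simp

section \<open>Memories as overlays of correct values\<close>

lemma histories_snoc:
  assumes "h \<in> histories P t" "x \<in> outcomes P (Suc t)"
  shows "h @ [x] \<in> histories P (Suc t)"
  using assms by (auto simp: histories_def nth_append le_Suc_eq)

lemma histories_take:
  assumes "h \<in> histories P n" "t \<le> n"
  shows "take t h \<in> histories P t"
  using assms by (auto simp: histories_def)

lemma histories_butlast:
  assumes "h \<in> histories P t"
  shows "butlast h \<in> histories P (t - 1)"
  using assms histories_take[of h P t "t - 1"] by (auto simp: histories_def butlast_conv_take)

text \<open>
  The initial memory stores the initial policies at prefixes of full histories.  Every shorter history
  is such a prefix: it can be continued by the tail of any full one.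
\<close>

lemma histories_extend:
  assumes "h \<in> histories P t" "\<xi> \<in> histories P n" "t \<le> n"
  shows "h \<in> take t ` histories P n"
proof -
  have "h @ drop t \<xi> \<in> histories P n"
    using assms by (auto simp: histories_def nth_append)
  moreover have "take t (h @ drop t \<xi>) = h"
    using assms(1) by (simp add: histories_def)
  ultimately show ?thesis
    by (metis imageI)
qed

lemma those_map_Some: "those (map (\<lambda>x. Some (f x)) xs) = Some (map f xs)"
  by (induction xs) auto

text \<open>
  The value that an entry must have whenever the algorithm has written it.  The last clause concerns
  labels that the algorithm never writes.
\<close>

fun target :: "problem \<Rightarrow> label \<Rightarrow> rvec" where
  "target P (Iterate t l h) = policy P l t h"
| "target P (Average t h) = average P (\<lambda>l. policy P l t h)"
| "target P _ = 0"

text \<open>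
  In contrast to \<^const>\<open>scratch_labels\<close>, the histories are genuine ones, so that the stored vectors
  are feasible.
\<close>

definition work_labels :: "problem \<Rightarrow> label set" where
  "work_labels P =
     {Iterate t l h | t l h. t \<in> {1..horizon P} \<and> l \<in> {1..updates P} \<and> h \<in> histories P t} \<union>
     {Average t h | t h. t \<in> {1..horizon P} \<and> h \<in> histories P t}"

definition iterates :: "nat \<Rightarrow> nat \<Rightarrow> rvec list \<Rightarrow> label set" where
  "iterates t l h = {Iterate t j h | j. j \<in> {1..l}}"

lemma iterates_image: "iterates t l h = (\<lambda>j. Iterate t j h) ` {1..l}"
  by (auto simp: iterates_def)

lemma iterates_0 [simp]: "iterates t 0 h = {}"
  by (simp add: iterates_def)

lemma iterates_Suc: "iterates t (Suc l) h = insert (Iterate t (Suc l) h) (iterates t l h)"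
  by (auto simp: iterates_def le_Suc_eq)

lemma Iterate_in_iterates [simp]:
  "Iterate t j h \<in> iterates t' l h' \<longleftrightarrow> t = t' \<and> h = h' \<and> 1 \<le> j \<and> j \<le> l"
  by (auto simp: iterates_def)

lemma Average_notin_iterates [simp]: "Average t h \<notin> iterates t' l h'"
  by (auto simp: iterates_def)

lemma iterates_subsetD:
  assumes "iterates t k h \<subseteq> A" "l \<le> k"
  shows "l = 0 \<or> Iterate t l h \<in> A"
  using assms by (cases l) (auto simp: subset_iff)

lemma finite_iterates [simp]: "finite (iterates t l h)"
  by (simp add: iterates_image)

lemma card_iterates [simp]: "card (iterates t l h) = l"
  by (simp add: iterates_image card_image inj_on_def)

lemma target_feasible:
  assumes "multistage P" "a \<in> work_labels P"
  shows "\<exists>t\<in>{1..horizon P}. target P a \<in> feasible P t"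
  using assms(2) policy_feasible[OF assms(1)] average_feasible[OF assms(1)]
  unfolding work_labels_def by (elim UnE CollectE exE conjE) fastforce+

lemma state_ops [simp]:
  "mem (store a x s) = (mem s)(a \<mapsto> Vector x)"
  "contents (store a x s) = insert ((mem s)(a \<mapsto> Vector x)) (contents s)"
  "grad_calls (store a x s) = grad_calls s"
  "prox_calls (store a x s) = prox_calls s"
  "mem (delete D s) = mem s |` (- D)"
  "contents (delete D s) = insert (mem s |` (- D)) (contents s)"
  "grad_calls (delete D s) = grad_calls s"
  "prox_calls (delete D s) = prox_calls s"
  "mem (count_update s) = mem s"
  "contents (count_update s) = contents s"
  "grad_calls (count_update s) = Suc (grad_calls s)"
  "prox_calls (count_update s) = Suc (prox_calls s)"
  by (simp_all add: store_def delete_def set_mem_def count_update_def)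

locale online_run =
  fixes P :: problem and \<xi> :: "rvec list" and M\<^sub>0 :: memory
  assumes problem: "multistage P"
    and outcome: "\<xi> \<in> histories P (horizon P)"
    and starting: "starting_memory P M\<^sub>0"
begin

abbreviation "T \<equiv> horizon P"
abbreviation "L \<equiv> updates P"

text \<open>
  The memory that contains the starting items and the correct values of the entries in \<open>A\<close>.  Every
  memory that occurs in a run has this form with \<open>A \<subseteq> work_labels P\<close>.
\<close>

definition overlay :: "label set \<Rightarrow> memory" where
  "overlay A = (\<lambda>a. if a \<in> A then Some (Vector (target P a)) else M\<^sub>0 a)"

lemma L_pos: "1 \<le> L"
  using problem unfolding multistage_def by auto

lemma work_labels_scratch: "work_labels P \<subseteq> scratch_labels P"
  by (auto simp: work_labels_def scratch_labels_def)

lemma scratch_unused: "a \<in> scratch_labels P \<Longrightarrow> M\<^sub>0 a = None"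
  using starting by (auto simp: starting_memory_def)

lemma work_unused: "a \<in> work_labels P \<Longrightarrow> M\<^sub>0 a = None"
  using work_labels_scratch scratch_unused by blast

lemma iterates_work:
  assumes "t \<in> {1..T}" "l \<le> L" "h \<in> histories P t"
  shows "iterates t l h \<subseteq> work_labels P"
  using assms by (auto simp: iterates_def work_labels_def)

lemma overlay_empty: "overlay {} = M\<^sub>0"
  by (simp add: overlay_def)

lemma overlay_store: "target P a = x \<Longrightarrow> (overlay A)(a \<mapsto> Vector x) = overlay (insert a A)"
  by (auto simp: overlay_def)

text \<open>
  The starting memory has no entry that the algorithm deletes, so a deletion never reaches below the
  overlay.
\<close>

lemma overlay_delete:
  assumes "D \<subseteq> scratch_labels P"
  shows "overlay A |` (- D) = overlay (A - D)"
  using assms scratch_unused by (fastforce simp: overlay_def restrict_map_def)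

lemma initial_memory_overlay:
  assumes "A \<subseteq> work_labels P"
  shows "initial_memory P \<subseteq>\<^sub>m overlay A"
proof -
  have "initial_memory P \<subseteq>\<^sub>m M\<^sub>0"
    using starting by (simp add: starting_memory_def)
  moreover have "M\<^sub>0 \<subseteq>\<^sub>m overlay A"
    using assms work_unused by (auto simp: map_le_def overlay_def)
  ultimately show ?thesis
    by (rule map_le_trans)
qed

text \<open>
  The iterate with index \<open>0\<close> is part of the starting memory, the others have to be in \<open>A\<close>.  This
  case distinction is what makes every read of the algorithm succeed.
\<close>

lemma overlay_Iterate:
  assumes "A \<subseteq> work_labels P" "t \<in> {1..T}" "h \<in> histories P t" "l = 0 \<or> Iterate t l h \<in> A"
  shows "overlay A (Iterate t l h) = Some (Vector (policy P l t h))"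
proof (cases "Iterate t l h \<in> A")
  case False
  then have [simp]: "l = 0" using assms(4) by simp
  have "initial_memory P (Iterate t l h) = Some (Vector (policy P l t h))"
    using assms(2,3) histories_extend[OF assms(3) outcome] by (simp add: initial_memory_def)
  then show ?thesis
    using initial_memory_overlay[OF assms(1)] by (metis domI map_le_def)
qed (simp add: overlay_def)

lemma overlay_Seed:
  assumes "A \<subseteq> work_labels P" "t \<in> {1..T}" "l \<le> L"
  shows "overlay A (Seed t l) = Some (Scalar (seed P t l))"
proof -
  have "initial_memory P (Seed t l) = Some (Scalar (seed P t l))"
    using assms(2,3) by (simp add: initial_memory_def)
  then show ?thesis
    using initial_memory_overlay[OF assms(1)] by (metis domI map_le_def)
qed

lemma read_Iterate:
  assumes "A \<subseteq> work_labels P" "t \<in> {1..T}" "h \<in> histories P t" "l = 0 \<or> Iterate t l h \<in> A"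
  shows "read_vector (overlay A) (Iterate t l h) = Some (policy P l t h)"
  by (simp add: read_vector_def overlay_Iterate[OF assms])

lemma extra_items_overlay:
  assumes "A \<subseteq> work_labels P"
  shows "extra_items (overlay A) M\<^sub>0 = (\<lambda>a. (a, Vector (target P a))) ` A"
  using assms work_unused
  by (fastforce simp: extra_items_def Map.graph_def overlay_def split: if_splits)

lemma graph_overlay:
  assumes "A \<subseteq> work_labels P"
  shows "Map.graph (overlay A) = Map.graph M\<^sub>0 \<union> (\<lambda>a. (a, Vector (target P a))) ` A"
  using assms work_unused
  by (fastforce simp: Map.graph_def overlay_def split: if_splits)

text \<open>
  The memories that add at most \<open>n\<close> items to \<open>overlay A\<close>: an upper bound for the contents occurring in a
  computation that is started on \<open>overlay A\<close> and keeps \<open>A\<close>.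
\<close>

definition snapshots :: "label set \<Rightarrow> nat \<Rightarrow> memory set" where
  "snapshots A n =
     {overlay (A \<union> E) | E. E \<subseteq> work_labels P \<and> finite E \<and> card E \<le> n}"

lemma snapshotsI:
  assumes "E \<subseteq> work_labels P" "finite E" "card E \<le> n"
  shows "overlay (A \<union> E) \<in> snapshots A n"
  using assms unfolding snapshots_def by blast

lemma snapshots_mono: "m \<le> n \<Longrightarrow> snapshots A m \<subseteq> snapshots A n"
  unfolding snapshots_def by fastforce

text \<open>
  A nested computation is started on \<open>A \<union> F\<close>; seen from \<open>A\<close>, its peak grows by the number of
  items in \<open>F\<close>.
\<close>

lemma snapshots_shift:
  assumes "F \<subseteq> work_labels P" "finite F" "card F + m \<le> n"
  shows "snapshots (A \<union> F) m \<subseteq> snapshots A n"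
proof
  fix M assume "M \<in> snapshots (A \<union> F) m"
  then obtain E where E: "M = overlay (A \<union> F \<union> E)" "E \<subseteq> work_labels P" "finite E" "card E \<le> m"
    unfolding snapshots_def by blast
  have "overlay (A \<union> (F \<union> E)) \<in> snapshots A n"
    using assms E card_Un_le[of F E] by (intro snapshotsI) auto
  then show "M \<in> snapshots A n"
    by (simp add: E(1) Un_assoc)
qed

section \<open>The evaluation procedure\<close>

text \<open>
  The sample handed to the update at stage \<open>t\<close>.  The sample and the items produced by the nested call
  are described for all stages at once: at the last stage there is no sample and there are no items.
\<close>

definition next_sample :: "nat \<Rightarrow> nat \<Rightarrow> rvec list \<Rightarrow> rvec option" where
  "next_sample t l h = (if t < T then Some (sampler P (Suc t) h (seed P t l)) else None)"

definition next_iterates :: "nat \<Rightarrow> nat \<Rightarrow> rvec list \<Rightarrow> label set" where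
  "next_iterates t l h =
     (case next_sample t l h of None \<Rightarrow> {} | Some x \<Rightarrow> iterates (Suc t) l (h @ [x]))"

lemma sample_history:
  assumes "t \<in> {1..T}" "t < T" "h \<in> histories P t" "l \<le> L"
  shows "h @ [sampler P (Suc t) h (seed P t l)] \<in> histories P (Suc t)"
proof -
  have "seed P t l \<in> {0..1}"
    using problem assms unfolding multistage_def by blast
  moreover have "\<forall>t\<in>{1..<T}. \<forall>h\<in>histories P t. \<forall>z\<in>{0..1}. sampler P (Suc t) h z \<in> outcomes P (Suc t)"
    using problem unfolding multistage_def by blast
  ultimately have "sampler P (Suc t) h (seed P t l) \<in> outcomes P (Suc t)"
    using assms by auto
  then show ?thesis
    using assms(3) by (rule histories_snoc[rotated])
qed

text \<open>
  The set \<open>A\<close> is the memory without the items of the nested call.  Those items are read and then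
  deleted; as they are disjoint from \<open>A\<close>, the deletion restores \<open>A\<close> exactly.
\<close>

lemma eval_update_run:
  assumes h: "t \<in> {1..T}" "h \<in> histories P t" "Suc l \<le> L"
    and m: "mem s = overlay (A \<union> next_iterates t l h)"
    and A: "A \<subseteq> work_labels P" "A \<inter> next_iterates t l h = {}" "iterates t l h \<subseteq> A"
    and prev: "t \<ge> 2 \<Longrightarrow> iterates (t - 1) l (butlast h) \<subseteq> A"
  shows "\<exists>s'. eval_update P t l h (next_sample t l h) s = Some s' \<and>
    mem s' = overlay (insert (Iterate t (Suc l) h) A) \<and>
    contents s' \<subseteq> contents s \<union> {overlay A, overlay (insert (Iterate t (Suc l) h) A)} \<and>
    grad_calls s' = Suc (grad_calls s) \<and> prox_calls s' = Suc (prox_calls s)"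
proof -
  let ?N = "next_iterates t l h"
  let ?a = "Iterate t (Suc l) h"
  define p where "p = (if t \<ge> 2 then Some (policy P l (t - 1) (butlast h)) else None)"
  have x: "read_vector (overlay (A \<union> N)) (Iterate t l h) = Some (policy P l t h)"
    if "N \<subseteq> work_labels P" for N
    using h A that by (intro read_Iterate) (auto simp: Suc_le_eq)
  have w: "(if t \<ge> 2 then map_option Some (read_vector (overlay (A \<union> N)) (Iterate (t - 1) l (butlast h)))
            else Some None) = Some p"
    if "N \<subseteq> work_labels P" for N
  proof (cases "t \<ge> 2")
    case True
    then have "read_vector (overlay (A \<union> N)) (Iterate (t - 1) l (butlast h)) =
        Some (policy P l (t - 1) (butlast h))"
      using h A(1) that iterates_subsetD[OF prev, of l] histories_butlast[OF h(2)]
      by (intro read_Iterate) auto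
    then show ?thesis using True by (simp add: p_def)
  qed (simp add: p_def)
  show ?thesis
  proof (cases "t < T")
    case True
    define z where "z = sampler P (Suc t) h (seed P t l)"
    have s: "next_sample t l h = Some z" "?N = iterates (Suc t) l (h @ [z])"
      using True by (auto simp: next_sample_def next_iterates_def z_def)
    have hz: "h @ [z] \<in> histories P (Suc t)"
      using sample_history[OF h(1) True h(2)] h(3) by (simp add: z_def)
    have N: "?N \<subseteq> work_labels P"
      unfolding s using True hz h(3) by (intro iterates_work) auto
    have y: "read_vector (overlay (A \<union> ?N)) (Iterate (Suc t) l (h @ [z])) =
        Some (policy P l (Suc t) (h @ [z]))"
      using A(1) N hz True by (intro read_Iterate) (auto simp: s)
    have D: "overlay (A \<union> ?N) |` (- iterates (Suc t) l (h @ [z])) = overlay A"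
    proof -
      have "A \<union> ?N - ?N = A" using A(2) by blast
      then show ?thesis
        using overlay_delete[of ?N "A \<union> ?N"] N work_labels_scratch unfolding s by auto
    qed
    \<comment> \<open>The values read are exactly those in the recursive definition of the policies.\<close>
    have step: "prox_update P t l (cond_grad P t p (policy P l t h) (last h)
        (Some (policy P l (Suc t) (h @ [z]), z))) (policy P l t h) = target P ?a"
      using True by (simp add: p_def z_def Let_def)
    show ?thesis
      unfolding eval_update_def iterates_def[symmetric] m s(1) x[OF N] w[OF N] Let_def
      by (auto simp: y m D step overlay_store[OF refl] simp del: target.simps)
  next
    case False
    then have s: "next_sample t l h = None" "?N = {}"
      by (auto simp: next_sample_def next_iterates_def)
    have step: "prox_update P t l (cond_grad P t p (policy P l t h) (last h) None) (policy P l t h) =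
        target P ?a"
      using False by (simp add: p_def Let_def)
    have m': "mem s = overlay A"
      using m s(2) by simp
    note xw = x[OF empty_subsetI, unfolded Un_empty_right] w[OF empty_subsetI, unfolded Un_empty_right]
    show ?thesis
      unfolding eval_update_def m' s(1) xw Let_def
      by (auto simp: m' step overlay_store[OF refl] simp del: target.simps)
  qed
qed

text \<open>
  The hypothesis that \<open>A\<close> has no iterates of stage \<open>t\<close> or later ensures that what the nested call at
  stage \<open>t + 1\<close> writes is new, hence that its deletion removes nothing else.  It is preserved by the
  nested call, which starts with iterates of stage \<open>t\<close> added.
\<close>

lemma eval_loop_run:
  assumes "t \<in> {1..T}" "h \<in> histories P t" "l \<le> L"
    and "mem s = overlay A" "A \<subseteq> work_labels P"
    and "\<forall>u j g. Iterate u j g \<in> A \<longrightarrow> u < t"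
    and "t \<ge> 2 \<Longrightarrow> iterates (t - 1) (l - 1) (butlast h) \<subseteq> A"
  shows "\<exists>s'. eval_loop P t l h s = Some s' \<and>
    mem s' = overlay (A \<union> iterates t l h) \<and>
    contents s' \<subseteq> contents s \<union> snapshots A (l\<^sup>2) \<and>
    grad_calls s' = grad_calls s + eval_cost l (Suc (T - t)) \<and>
    prox_calls s' = prox_calls s + eval_cost l (Suc (T - t))"
  using assms
proof (induction l arbitrary: t h s A)
  case 0
  then show ?case by auto
next
  case (Suc l)
  note h = Suc.prems(1-3) and A = Suc.prems(5-7)
  have "iterates (t - 1) (l - 1) (butlast h) \<subseteq> A" if "t \<ge> 2"
    using A(3)[OF that] by (auto simp: iterates_def)
  then obtain s1 where s1: "eval_loop P t l h s = Some s1"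
    "mem s1 = overlay (A \<union> iterates t l h)"
    "contents s1 \<subseteq> contents s \<union> snapshots A (l\<^sup>2)"
    "grad_calls s1 = grad_calls s + eval_cost l (Suc (T - t))"
    "prox_calls s1 = prox_calls s + eval_cost l (Suc (T - t))"
    using Suc.IH[OF h(1,2) _ Suc.prems(4) A(1,2)] h(3) by auto
  \<comment> \<open>the labels present when the nested call starts\<close>
  define B where "B = A \<union> iterates t l h"
  define c where "c = eval_cost l (T - t)"
  have own: "iterates t k h \<subseteq> work_labels P" if "k \<le> L" for k
    using that h by (intro iterates_work)
  have B: "B \<subseteq> work_labels P" "\<forall>u j g. Iterate u j g \<in> B \<longrightarrow> u < Suc t" "iterates t l h \<subseteq> B"
    using A(1) A(2) own[of l] h(3) by (auto simp: B_def less_Suc_eq)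
  have sq: "(Suc l)\<^sup>2 = l\<^sup>2 + 2 * l + 1"
    by (simp add: power2_eq_square)
  have snap: "snapshots B (l\<^sup>2) \<subseteq> snapshots A ((Suc l)\<^sup>2)"
    unfolding B_def using own[of l] h(3) by (intro snapshots_shift) (auto simp: sq)
  have snap': "snapshots A (l\<^sup>2) \<subseteq> snapshots A ((Suc l)\<^sup>2)"
    by (intro snapshots_mono) (simp add: sq)
  have steps: "overlay B \<in> snapshots A ((Suc l)\<^sup>2)"
    "overlay (insert (Iterate t (Suc l) h) B) \<in> snapshots A ((Suc l)\<^sup>2)"
    using snapshotsI[OF own[of l], of "(Suc l)\<^sup>2" A] snapshotsI[OF own[of "Suc l"], of "(Suc l)\<^sup>2" A] h(3)
    by (auto simp: B_def iterates_Suc sq)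
  \<comment> \<open>\<open>s2\<close> is the state just before the update: after the nested call, or \<open>s1\<close> itself if \<open>t = T\<close>.\<close>
  obtain s2 where s2: "eval_loop P t (Suc l) h s = eval_update P t l h (next_sample t l h) s2"
    "mem s2 = overlay (B \<union> next_iterates t l h)"
    "contents s2 \<subseteq> contents s1 \<union> snapshots B (l\<^sup>2)"
    "grad_calls s2 = grad_calls s1 + c" "prox_calls s2 = prox_calls s1 + c"
  proof (cases "t < T")
    case True
    define z where "z = sampler P (Suc t) h (seed P t l)"
    have z: "next_sample t l h = Some z" "next_iterates t l h = iterates (Suc t) l (h @ [z])"
      using True by (auto simp: next_sample_def next_iterates_def z_def)
    have hz: "h @ [z] \<in> histories P (Suc t)"
      using sample_history[OF h(1) True h(2)] h(3) by (simp add: z_def)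
    have seed: "read_scalar (overlay B) (Seed t l) = Some (seed P t l)"
      using overlay_Seed[OF B(1) h(1)] h(3) by (simp add: read_scalar_def)
    have pre: "eval_pre P (Suc t) l (h @ [z]) (overlay B)"
      unfolding eval_pre_def
      using initial_memory_overlay[OF B(1)] overlay_Iterate[OF B(1) h(1,2)] iterates_subsetD[OF B(3)]
      by simp
    have "iterates (Suc t - 1) (l - 1) (butlast (h @ [z])) \<subseteq> B"
      using B(3) by (auto simp: iterates_def)
    then obtain s2 where "eval_loop P (Suc t) l (h @ [z]) s1 = Some s2"
      "mem s2 = overlay (B \<union> iterates (Suc t) l (h @ [z]))"
      "contents s2 \<subseteq> contents s1 \<union> snapshots B (l\<^sup>2)"
      "grad_calls s2 = grad_calls s1 + eval_cost l (Suc (T - Suc t))"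
      "prox_calls s2 = prox_calls s1 + eval_cost l (Suc (T - Suc t))"
      using Suc.IH[OF _ hz _ _ B(1,2), of s1] True h(3) s1(2) by (auto simp: B_def)
    moreover have "Suc (T - Suc t) = T - t"
      using True by simp
    ultimately show thesis
      using True seed pre s1(1,2) by (intro that[of s2]) (auto simp: z c_def simp flip: z_def B_def)
  next
    case False
    then have "next_sample t l h = None" "next_iterates t l h = {}" "c = 0"
      using h(1) by (auto simp: next_sample_def next_iterates_def c_def eval_cost_no_stage)
    then show thesis
      using False s1 by (intro that[of s1]) (auto simp: B_def)
  qed
  have disj: "B \<inter> next_iterates t l h = {}"
    using B(2) by (fastforce simp: next_iterates_def iterates_def split: option.splits)
  obtain s3 where s3: "eval_update P t l h (next_sample t l h) s2 = Some s3"
    "mem s3 = overlay (insert (Iterate t (Suc l) h) B)"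
    "contents s3 \<subseteq> contents s2 \<union> {overlay B, overlay (insert (Iterate t (Suc l) h) B)}"
    "grad_calls s3 = Suc (grad_calls s2)" "prox_calls s3 = Suc (prox_calls s2)"
    using eval_update_run[OF h(1,2,3) s2(2) B(1) disj B(3)] A(3) by (auto simp: B_def)
  have "mem s3 = overlay (A \<union> iterates t (Suc l) h)"
    using s3(2) by (simp add: B_def iterates_Suc)
  moreover have "contents s3 \<subseteq> contents s \<union> snapshots A ((Suc l)\<^sup>2)"
    using s3(3) s2(3) s1(3) snap snap' steps by blast
  moreover have "grad_calls s3 = grad_calls s + eval_cost (Suc l) (Suc (T - t))"
    "prox_calls s3 = prox_calls s + eval_cost (Suc l) (Suc (T - t))"
    using s1 s2 s3 by (auto simp: c_def)
  ultimately show ?case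
    using s2(1) s3(1) by metis
qed

section \<open>The online algorithm\<close>

text \<open>
  The items present at the end of stage \<open>t\<close>; stage \<open>0\<close> is the start, where nothing has been added.
\<close>

definition stage_labels :: "nat \<Rightarrow> label set" where
  "stage_labels t =
     (if t = 0 then {} else insert (Average t (take t \<xi>)) (iterates t L (take t \<xi>)))"

lemma prefix_history: "t \<le> T \<Longrightarrow> take t \<xi> \<in> histories P t"
  using histories_take[OF outcome] .

lemma butlast_prefix:
  assumes "Suc t \<le> T"
  shows "butlast (take (Suc t) \<xi>) = take t \<xi>"
  using assms outcome by (simp add: butlast_take histories_def)

lemma stage_labels_work:
  assumes "t \<le> T"
  shows "stage_labels t \<subseteq> work_labels P"
proof (cases "t = 0")
  case False
  then have "Average t (take t \<xi>) \<in> work_labels P" "iterates t L (take t \<xi>) \<subseteq> work_labels P"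
    using assms prefix_history[OF assms] iterates_work[of t L "take t \<xi>"] by (auto simp: work_labels_def)
  then show ?thesis by (simp add: stage_labels_def)
qed (simp add: stage_labels_def)

lemma finite_stage_labels [simp]: "finite (stage_labels t)"
  by (simp add: stage_labels_def)

lemma card_stage_labels: "t \<noteq> 0 \<Longrightarrow> card (stage_labels t) = L + 1"
  unfolding stage_labels_def by (subst if_not_P) (auto simp: card_insert_if)

text \<open>
  The items of the previous stage provide the precondition of the evaluation and stay until the end of
  the stage.  The constant \<open>4\<close> covers both \<open>(L + 1) + L\<^sup>2\<close>, the peak during the evaluation, and
  \<open>2 (L + 1)\<close>, the items of both stages just before the deletion.
\<close>

lemma stage_run:
  assumes t: "Suc t \<le> T" and m: "mem s = overlay (stage_labels t)"
  shows "\<exists>s'. stage P (Suc t) (take (Suc t) \<xi>) s = Some s' \<and>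
    mem s' = overlay (stage_labels (Suc t)) \<and>
    contents s' \<subseteq> contents s \<union> snapshots {} (4 * L\<^sup>2) \<and>
    grad_calls s' = grad_calls s + eval_cost L (T - t) \<and>
    prox_calls s' = prox_calls s + eval_cost L (T - t)"
proof -
  let ?h = "take (Suc t) \<xi>"
  let ?A = "stage_labels t"
  let ?I = "iterates (Suc t) L ?h"
  let ?a = "Average (Suc t) ?h"
  have h: "Suc t \<in> {1..T}" "?h \<in> histories P (Suc t)"
    using t prefix_history[OF t] by auto
  have A: "?A \<subseteq> work_labels P" "\<forall>u j g. Iterate u j g \<in> ?A \<longrightarrow> u < Suc t"
    using stage_labels_work[of t] t by (auto simp: stage_labels_def split: if_splits)
  have new: "stage_labels (Suc t) = insert ?a ?I"
    by (simp add: stage_labels_def)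
  have prev: "iterates (Suc t - 1) k (butlast ?h) \<subseteq> ?A" if "Suc t \<ge> 2" "k \<le> L" for k
    using that butlast_prefix[OF t] by (auto simp: stage_labels_def iterates_def)
  have prev': "iterates (Suc t - 1) (L - 1) (butlast ?h) \<subseteq> ?A" if "Suc t \<ge> 2"
    using prev[OF that] by simp
  have pre: "eval_pre P (Suc t) L ?h (mem s)"
    unfolding eval_pre_def m
  proof (intro conjI impI allI)
    fix l assume "2 \<le> Suc t" "l < L"
    then show "overlay ?A (Iterate (Suc t - 1) l (butlast ?h)) =
        Some (Vector (policy P l (Suc t - 1) (butlast ?h)))"
      using A(1) t histories_butlast[OF h(2)] iterates_subsetD[OF prev[of L], of l]
      by (intro overlay_Iterate) auto
  qed (rule initial_memory_overlay[OF A(1)])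
  obtain s1 where s1: "evaluate P (Suc t) L ?h s = Some s1"
    "mem s1 = overlay (?A \<union> ?I)"
    "contents s1 \<subseteq> contents s \<union> snapshots ?A (L\<^sup>2)"
    "grad_calls s1 = grad_calls s + eval_cost L (T - t)"
    "prox_calls s1 = prox_calls s + eval_cost L (T - t)"
    using eval_loop_run[OF h order_refl m A prev'] pre t
    by (auto simp: evaluate_def Suc_diff_Suc)
  have I: "?I \<subseteq> work_labels P"
    using h by (intro iterates_work) auto
  have AI: "?A \<union> ?I \<subseteq> work_labels P" using A(1) I by simp
  have read: "read_vector (overlay (?A \<union> ?I)) (Iterate (Suc t) l ?h) = Some (policy P l (Suc t) ?h)"
    if "l \<le> L" for l
    using that AI h by (intro read_Iterate) auto
  \<comment> \<open>The averaging reads the iterates as a list, index \<open>0\<close> included.\<close>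
  have xs: "those (map (\<lambda>l. read_vector (mem s1) (Iterate (Suc t) l ?h)) [0..<Suc L]) =
      Some (map (\<lambda>l. policy P l (Suc t) ?h) [0..<Suc L])"
  proof -
    have "map (\<lambda>l. read_vector (mem s1) (Iterate (Suc t) l ?h)) [0..<Suc L] =
        map (\<lambda>l. Some (policy P l (Suc t) ?h)) [0..<Suc L]"
      using read by (intro map_cong) (auto simp: s1(2))
    then show ?thesis by (simp only: those_map_Some)
  qed
  have avg: "average P (nth (map (\<lambda>l. policy P l (Suc t) ?h) [0..<Suc L])) = target P ?a"
    unfolding average_def target.simps
    by (intro arg_cong2[where f = "(/\<^sub>R)"] sum.cong) (auto simp del: upt_Suc simp: nth_map)
  define s2 where "s2 = store ?a (target P ?a) s1"
  have s2: "mem s2 = overlay (?A \<union> stage_labels (Suc t))"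
    "contents s2 \<subseteq> insert (overlay (?A \<union> stage_labels (Suc t))) (contents s1)"
    using overlay_store[OF refl, of "?A \<union> ?I" ?a] by (auto simp: s2_def s1(2) new)
  define D where "D = insert (Average t (take t \<xi>)) (iterates t L (take t \<xi>))"
  define s3 where "s3 = (if Suc t \<ge> 2 then delete D s2 else s2)"
  have run: "stage P (Suc t) ?h s = Some s3"
    using xs avg butlast_prefix[OF t]
    by (simp add: stage_def s1(1) s2_def s3_def D_def iterates_def Let_def del: upt_Suc target.simps)
  \<comment> \<open>At the first stage there is no previous item; afterwards exactly \<open>?A\<close> is deleted.\<close>
  have D: "overlay (?A \<union> stage_labels (Suc t)) |` (- D) = overlay (stage_labels (Suc t))" if "t \<noteq> 0"
  proof -
    have "?A = D" using that by (simp add: stage_labels_def D_def)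
    moreover have "stage_labels (Suc t) \<inter> D = {}"
      by (auto simp: new D_def iterates_def)
    ultimately have "?A \<union> stage_labels (Suc t) - D = stage_labels (Suc t)" by blast
    then show ?thesis
      using overlay_delete[of D] A(1) \<open>?A = D\<close> work_labels_scratch by simp
  qed
  have s3: "mem s3 = overlay (stage_labels (Suc t))"
    "contents s3 \<subseteq> insert (overlay (stage_labels (Suc t)))
       (insert (overlay (?A \<union> stage_labels (Suc t))) (contents s1))"
    using s2 D by (auto simp: s3_def stage_labels_def)
  have LL: "L \<le> L\<^sup>2" "1 \<le> L\<^sup>2"
    using L_pos by (auto simp: power2_eq_square)
  have cA: "card ?A \<le> L + 1"
    using card_stage_labels[of t] by (cases "t = 0") (auto simp: stage_labels_def)
  have c': "card (stage_labels (Suc t)) = L + 1"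
    by (simp add: card_stage_labels)
  have "snapshots ({} \<union> ?A) (L\<^sup>2) \<subseteq> snapshots {} (4 * L\<^sup>2)"
    using A(1) cA LL by (intro snapshots_shift) auto
  moreover have "overlay ({} \<union> (?A \<union> stage_labels (Suc t))) \<in> snapshots {} (4 * L\<^sup>2)"
    using A(1) cA c' LL stage_labels_work[OF t] card_Un_le[of ?A "stage_labels (Suc t)"]
    by (intro snapshotsI) auto
  moreover have "overlay ({} \<union> stage_labels (Suc t)) \<in> snapshots {} (4 * L\<^sup>2)"
    using c' LL stage_labels_work[OF t] by (intro snapshotsI) auto
  ultimately have "contents s3 \<subseteq> contents s \<union> snapshots {} (4 * L\<^sup>2)"
    using s3(2) s1(3) by auto
  moreover have "grad_calls s3 = grad_calls s1" "prox_calls s3 = prox_calls s1"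
    by (simp_all add: s3_def s2_def)
  ultimately show ?thesis
    using run s3(1) s1(4,5) by simp
qed

lemma eval_cost_stage: "eval_cost L (T - t) \<le> min (2 ^ L) (L ^ T)"
proof -
  have "L ^ (T - t) \<le> L ^ T"
    using L_pos by (intro power_increasing) auto
  then show ?thesis
    using eval_cost_le_power[of L "T - t"] eval_cost_le_exponential[of L "T - t"] by simp
qed

lemma online_correct:
  assumes "t \<le> T"
  shows "\<exists>s. online P \<xi> t M\<^sub>0 = Some s \<and> mem s = overlay (stage_labels t) \<and>
    contents s \<subseteq> snapshots {} (4 * L\<^sup>2) \<and>
    grad_calls s \<le> t * min (2 ^ L) (L ^ T) \<and> prox_calls s \<le> t * min (2 ^ L) (L ^ T)"
  using assms
proof (induction t)
  case 0
  have "overlay ({} \<union> {}) \<in> snapshots {} (4 * L\<^sup>2)"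
    by (intro snapshotsI) auto
  then show ?case
    by (simp add: start_def stage_labels_def overlay_empty)
next
  case (Suc t)
  then obtain s where s: "online P \<xi> t M\<^sub>0 = Some s" "mem s = overlay (stage_labels t)"
    "contents s \<subseteq> snapshots {} (4 * L\<^sup>2)"
    "grad_calls s \<le> t * min (2 ^ L) (L ^ T)" "prox_calls s \<le> t * min (2 ^ L) (L ^ T)"
    by auto
  show ?case
    using stage_run[OF Suc.prems s(2)] s eval_cost_stage[of t] by fastforce
qed

lemma snapshot_storage:
  assumes bits: "\<And>t x. t \<in> {1..T} \<Longrightarrow> x \<in> feasible P t \<Longrightarrow> bits (Vector x) \<le> (B :: nat)"
    and M: "M \<in> snapshots {} n"
  shows "finite (extra_items M M\<^sub>0)" "(\<Sum>(a, v)\<in>extra_items M M\<^sub>0. bits v) \<le> n * B"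
proof -
  obtain E where E: "M = overlay E" "E \<subseteq> work_labels P" "finite E" "card E \<le> n"
    using M by (auto simp: snapshots_def)
  have X: "extra_items M M\<^sub>0 = (\<lambda>a. (a, Vector (target P a))) ` E"
    using extra_items_overlay[OF E(2)] E(1) by simp
  then show "finite (extra_items M M\<^sub>0)" using E(3) by simp
  have "(\<Sum>(a, v)\<in>extra_items M M\<^sub>0. bits v) = (\<Sum>a\<in>E. bits (Vector (target P a)))"
    unfolding X by (subst sum.reindex) (auto simp: inj_on_def)
  also have "\<dots> \<le> card E * B"
    using E(2) target_feasible[OF problem] bits
    by (intro sum_bounded_above[where K = B, simplified]) blast
  also have "\<dots> \<le> n * B"
    using E(4) by simp
  finally show "(\<Sum>(a, v)\<in>extra_items M M\<^sub>0. bits v) \<le> n * B" .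
qed

lemma stage_items:
  assumes "t \<in> {1..T}"
  shows "Map.graph (overlay (stage_labels t)) = Map.graph M\<^sub>0 \<union>
      ({(Iterate t l (take t \<xi>), Vector (policy P l t (take t \<xi>))) | l. l \<in> {1..L}} \<union>
       {(Average t (take t \<xi>), Vector (average P (\<lambda>l. policy P l t (take t \<xi>))))})"
    and "card (extra_items (overlay (stage_labels t)) M\<^sub>0) = L + 1"
    and "\<forall>(a, v)\<in>extra_items (overlay (stage_labels t)) M\<^sub>0. \<exists>x\<in>feasible P t. v = Vector x"
proof -
  let ?h = "take t \<xi>"
  have t: "t \<noteq> 0" "t \<le> T" using assms by auto
  have W: "stage_labels t \<subseteq> work_labels P"
    using stage_labels_work t by simp
  have S: "stage_labels t = insert (Average t ?h) ((\<lambda>l. Iterate t l ?h) ` {1..L})"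
    using t by (simp add: stage_labels_def iterates_image)
  show "Map.graph (overlay (stage_labels t)) = Map.graph M\<^sub>0 \<union>
      ({(Iterate t l ?h, Vector (policy P l t ?h)) | l. l \<in> {1..L}} \<union>
       {(Average t ?h, Vector (average P (\<lambda>l. policy P l t ?h)))})"
    unfolding graph_overlay[OF W] unfolding S by (auto simp: image_iff)
  have "inj_on (\<lambda>a. (a, Vector (target P a))) (stage_labels t)"
    by (simp add: inj_on_def)
  then show "card (extra_items (overlay (stage_labels t)) M\<^sub>0) = L + 1"
    using card_stage_labels[OF t(1)] by (simp add: extra_items_overlay[OF W] card_image)
  have "policy P l t ?h \<in> feasible P t" for l
    using policy_feasible[OF problem assms prefix_history[OF t(2)]] .
  then have "target P a \<in> feasible P t" if "a \<in> stage_labels t" for a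
    using that average_feasible[OF problem assms] by (auto simp: S)
  then show "\<forall>(a, v)\<in>extra_items (overlay (stage_labels t)) M\<^sub>0. \<exists>x\<in>feasible P t. v = Vector x"
    unfolding extra_items_overlay[OF W] by auto
qed

lemma stage_output:
  assumes "t \<in> {1..T}"
  shows "\<exists>s. online P \<xi> t M\<^sub>0 = Some s \<and>
      Map.graph (mem s) = Map.graph M\<^sub>0 \<union>
        ({(Iterate t l (take t \<xi>), Vector (policy P l t (take t \<xi>))) | l. l \<in> {1..L}} \<union>
         {(Average t (take t \<xi>), Vector (average P (\<lambda>l. policy P l t (take t \<xi>))))}) \<and>
      card (extra_items (mem s) M\<^sub>0) = L + 1 \<and>
      (\<forall>(a, v)\<in>extra_items (mem s) M\<^sub>0. \<exists>x\<in>feasible P t. v = Vector x)"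
proof -
  obtain s where s: "online P \<xi> t M\<^sub>0 = Some s" "mem s = overlay (stage_labels t)"
    using online_correct[of t] assms by auto
  show ?thesis
    by (rule exI[of _ s], unfold s(2), intro conjI s(1) stage_items[OF assms])
qed

lemma run_resources:
  "\<exists>s. online P \<xi> T M\<^sub>0 = Some s \<and>
    real (grad_calls s) \<le> real T * min (2 ^ L) (real L ^ T) \<and>
    real (prox_calls s) \<le> real T * min (2 ^ L) (real L ^ T) \<and>
    (\<forall>(bits :: stored \<Rightarrow> nat) (B :: nat).
       (\<forall>t\<in>{1..T}. \<forall>x\<in>feasible P t. bits (Vector x) \<le> B) \<longrightarrow>
       (\<forall>M\<in>contents s. finite (extra_items M M\<^sub>0) \<and>
          real (\<Sum>(a, v)\<in>extra_items M M\<^sub>0. bits v) \<le> 4 * (real L ^ 2 * real B)))"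
proof -
  have cost: "real n \<le> real T * min (2 ^ L) (real L ^ T)" if "n \<le> T * min (2 ^ L) (L ^ T)" for n
    using of_nat_mono[OF that, where 'a = real] by (simp add: of_nat_min)
  have storage: "finite (extra_items M M\<^sub>0) \<and>
      real (\<Sum>(a, v)\<in>extra_items M M\<^sub>0. bits v) \<le> 4 * (real L ^ 2 * real B)"
    if "\<forall>t\<in>{1..T}. \<forall>x\<in>feasible P t. bits (Vector x) \<le> B" "M \<in> snapshots {} (4 * L\<^sup>2)"
    for M and bits :: "stored \<Rightarrow> nat" and B
  proof -
    have "(\<Sum>(a, v)\<in>extra_items M M\<^sub>0. bits v) \<le> 4 * L\<^sup>2 * B" "finite (extra_items M M\<^sub>0)"
      using snapshot_storage[of bits B] that by auto
    from of_nat_mono[OF this(1), where 'a = real] this(2) show ?thesis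
      by (simp only: of_nat_mult of_nat_power of_nat_numeral mult.assoc simp_thms)
  qed
  obtain s where s: "online P \<xi> T M\<^sub>0 = Some s" "contents s \<subseteq> snapshots {} (4 * L\<^sup>2)"
    "grad_calls s \<le> T * min (2 ^ L) (L ^ T)" "prox_calls s \<le> T * min (2 ^ L) (L ^ T)"
    using online_correct[OF order_refl] by blast
  show ?thesis
    by (intro exI[of _ s] conjI s(1) cost[OF s(3)] cost[OF s(4)] allI impI ballI)
      (use storage s(2) in blast)+
qed

end

theorem theorem5p1:
  shows "\<exists>C\<^sub>g C\<^sub>p C\<^sub>m :: real. \<forall>P \<xi> M\<^sub>0.
    multistage P \<longrightarrow> \<xi> \<in> histories P (horizon P) \<longrightarrow> starting_memory P M\<^sub>0 \<longrightarrow>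
    (let T = horizon P; L = updates P in
      (\<forall>t\<in>{1..T}. \<exists>s. online P \<xi> t M\<^sub>0 = Some s \<and>
         (let h = take t \<xi> in
            Map.graph (mem s) = Map.graph M\<^sub>0 \<union>
              ({(Iterate t l h, Vector (policy P l t h)) | l. l \<in> {1..L}} \<union>
               {(Average t h, Vector (average P (\<lambda>l. policy P l t h)))})) \<and>
         card (extra_items (mem s) M\<^sub>0) = L + 1 \<and>
         (\<forall>(a, v)\<in>extra_items (mem s) M\<^sub>0. \<exists>x\<in>feasible P t. v = Vector x)) \<and>
      (\<exists>s. online P \<xi> T M\<^sub>0 = Some s \<and>
         real (grad_calls s) \<le> C\<^sub>g * (real T * min (2 ^ L) (real L ^ T)) \<and>
         real (prox_calls s) \<le> C\<^sub>p * (real T * min (2 ^ L) (real L ^ T)) \<and>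
         (\<forall>(bits :: stored \<Rightarrow> nat) (B :: nat).
            (\<forall>t\<in>{1..T}. \<forall>x\<in>feasible P t. bits (Vector x) \<le> B) \<longrightarrow>
            (\<forall>M\<in>contents s.
               finite (extra_items M M\<^sub>0) \<and>
               real (\<Sum>(a, v)\<in>extra_items M M\<^sub>0. bits v) \<le> C\<^sub>m * (real L ^ 2 * real B)))))"
    unfolding Let_def
  by (rule exI[of _ 1], rule exI[of _ 1], rule exI[of _ 4], unfold mult_1, intro allI impI conjI ballI)
    (intro online_run.stage_output online_run.run_resources online_run.intro; assumption)+

end
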